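(* Let $F$ be a simple graph of order $n\ge1$ and let $V_k=\{v_1,\ldots,v_k\}\subseteq V(F)$ with $|V_k|=k$. Let $H_u$ and $H_v$ be two disjoint simple graphs of order $m$ with specified vertices $u$ of $H_u$ and $v$ of $H_v$, each of degree $m-1$ in its graph, such that $H_u-u$ and $H_v-v$ are $r_1$-regular, where $m\ge2$ and $r_1\ge1$. If $H_u$ and $H_v$ are $A$-cospectral, then $G[F,V_k,H_u]$ and $G[F,V_k,H_v]$ are $A$-cospectral.
   Context: All graphs are finite and simple. Two graphs are $A$-cospectral if their adjacency matrices have the same spectrum (with multiplicities). Graph with $k$ pockets: for a graph $H_w$ with specified vertex $w$, $G[F,V_k,H_w]$ is obtained by taking one copy of $F$ and $k$ vertex-disjoint copies of $H_w$, and, for each $i=1,\ldots,k$, identifying the vertex $w$ of the $i$th copy of $H_w$ with the vertex $v_i$ of $F$. *)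

theory Defs
  imports
    "Graph_Theory.Pair_Digraph"
    "Jordan_Normal_Form.Spectral_Radius"
begin

text \<open>
  Finite simple graphs are \<^locale>\<open>pair_graph\<close>s: a finite vertex set together with an
  irreflexive symmetric set of arcs, every edge being represented by its two
  orientations. The degree of a vertex is therefore its \<^const>\<open>out_degree\<close>.
\<close>

definition regular :: "nat \<Rightarrow> ('a, 'b) pre_digraph \<Rightarrow> bool" where
  "regular r G \<longleftrightarrow> (\<forall>x \<in> verts G. out_degree G x = r)"

text \<open>
  The adjacency matrix has complex entries, so that its characteristic polynomial
  splits and \<^const>\<open>proots\<close> loses no eigenvalue.
\<close>

definition adj_mat :: "'a list \<Rightarrow> 'a pair_pre_digraph \<Rightarrow> complex mat" where
  "adj_mat xs G = mat (length xs) (length xs) (\<lambda>(i, j). of_bool ((xs ! i, xs ! j) \<in> parcs G))"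

definition mat_spectrum :: "complex mat \<Rightarrow> complex multiset" where
  "mat_spectrum A = proots (char_poly A)"

text \<open>
  The choice of the vertex enumeration is immaterial, see \<open>adj_spectrum_eq\<close> below.
\<close>

definition adj_spectrum :: "'a pair_pre_digraph \<Rightarrow> complex multiset" where
  "adj_spectrum G = mat_spectrum (adj_mat (SOME xs. distinct xs \<and> set xs = pverts G) G)"

definition A_cospectral :: "'a pair_pre_digraph \<Rightarrow> 'b pair_pre_digraph \<Rightarrow> bool" where
  "A_cospectral G H \<longleftrightarrow> adj_spectrum G = adj_spectrum H"

text \<open>
  \<open>pocket_emb p w i\<close> places the \<open>i\<close>-th copy of \<open>H\<close> in the graph with pockets: its
  vertex \<open>w\<close> is identified with the vertex \<open>p i\<close> of \<open>F\<close>, its other vertices are new.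
\<close>

definition pocket_emb :: "(nat \<Rightarrow> 'a) \<Rightarrow> 'b \<Rightarrow> nat \<Rightarrow> 'b \<Rightarrow> 'a + nat \<times> 'b" where
  "pocket_emb p w i x = (if x = w then Inl (p i) else Inr (i, x))"

definition pockets ::
  "'a pair_pre_digraph \<Rightarrow> nat \<Rightarrow> (nat \<Rightarrow> 'a) \<Rightarrow> 'b pair_pre_digraph \<Rightarrow> 'b
    \<Rightarrow> ('a + nat \<times> 'b) pair_pre_digraph" where
  "pockets F k p H w = \<lparr>
     pverts = Inl ` pverts F \<union> (\<Union>i\<in>{1..k}. pocket_emb p w i ` pverts H),
     parcs = map_prod Inl Inl ` parcs F
       \<union> (\<Union>i\<in>{1..k}. map_prod (pocket_emb p w i) (pocket_emb p w i) ` parcs H) \<rparr>"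

lemma set_mset_mat_spectrum:
  assumes "A \<in> carrier_mat n n"
  shows "set_mset (mat_spectrum A) = spectrum A"
proof -
  have "char_poly A \<noteq> 0"
    using degree_monic_char_poly[OF assms] by auto
  then show ?thesis
    unfolding mat_spectrum_def spectrum_root_char_poly[OF assms] by simp
qed

lemma size_mat_spectrum:
  assumes "A \<in> carrier_mat n n"
  shows "size (mat_spectrum A) = n"
proof -
  obtain as where as: "char_poly A = (\<Prod>a\<leftarrow>as. [:- a, 1:])" "length as = n"
    using char_poly_factorized[OF assms] by blast
  have "proots (\<Prod>a\<leftarrow>as. [:- a, 1:]) = mset as" for as :: "complex list"
  proof (induction as)
    case (Cons a as)
    have "(\<Prod>a\<leftarrow>as. [:- a, 1:]) \<noteq> (0 :: complex poly)"
      by (auto simp: prod_list_zero_iff)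
    then have "proots ([:- a, 1:] * (\<Prod>a\<leftarrow>as. [:- a, 1:]))
        = proots [:- a, 1:] + proots (\<Prod>a\<leftarrow>as. [:- a, 1:])"
      by (intro proots_mult) auto
    with Cons show ?case by simp
  qed simp
  with as show ?thesis unfolding mat_spectrum_def by simp
qed

lemma similar_adj_mat:
  assumes xs: "distinct xs" and ys: "distinct ys" and set_eq: "set xs = set ys"
  shows "similar_mat (adj_mat xs G) (adj_mat ys G)"
proof -
  define n where "n = length xs"
  have len: "length xs = n" "length ys = n"
    using distinct_card[OF xs] distinct_card[OF ys] set_eq unfolding n_def by auto
  define M :: "'a list \<Rightarrow> 'a list \<Rightarrow> complex mat" where
    "M = (\<lambda>as bs. mat n n (\<lambda>(i, j). of_bool (as ! i = bs ! j)))"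
  have mult: "M as bs * mat n n (\<lambda>(i, j). f (bs ! i) j) = mat n n (\<lambda>(i, j). f (as ! i) j)"
    if bs: "distinct bs" "length bs = n" "length as = n" "set as = set bs"
    for as bs :: "'a list" and f :: "'a \<Rightarrow> nat \<Rightarrow> complex"
  proof (rule eq_matI)
    fix i j
    assume "i < dim_row (mat n n (\<lambda>(i, j). f (as ! i) j))"
      "j < dim_col (mat n n (\<lambda>(i, j). f (as ! i) j))"
    then have i: "i < n" and j: "j < n" by auto
    obtain l where l: "l < n" "bs ! l = as ! i"
      using i bs by (metis in_set_conv_nth)
    have "(\<Sum>t = 0..<n. of_bool (as ! i = bs ! t) * f (bs ! t) j)
        = (\<Sum>t = 0..<n. if t = l then f (as ! i) j else 0)"
      using l bs by (intro sum.cong) (auto simp: nth_eq_iff_index_eq simp flip: l(2))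
    then show "(M as bs * mat n n (\<lambda>(i, j). f (bs ! i) j)) $$ (i, j)
        = mat n n (\<lambda>(i, j). f (as ! i) j) $$ (i, j)"
      using i j l by (simp add: M_def scalar_prod_def)
  qed (auto simp: M_def)
  have id: "M as bs * M bs as = 1\<^sub>m n"
    if "distinct as" "distinct bs" "length bs = n" "length as = n" "set as = set bs" for as bs
  proof -
    have "M as bs * M bs as = M as as"
      using mult[of bs as "\<lambda>x j. of_bool (x = as ! j)"] that by (simp add: M_def)
    also have "\<dots> = 1\<^sub>m n"
      using that by (intro eq_matI) (auto simp: M_def nth_eq_iff_index_eq)
    finally show ?thesis .
  qed
  have C: "M as bs \<in> carrier_mat n n" for as bs
    by (simp add: M_def)
  have A: "adj_mat as G \<in> carrier_mat n n" if "length as = n" for as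
    using that by (simp add: adj_mat_def)
  define N where "N = mat n n (\<lambda>(i, j). of_bool ((xs ! i, ys ! j) \<in> parcs G) :: complex)"
  have 1: "M xs ys * adj_mat ys G = N"
    using mult[of ys xs "\<lambda>x j. of_bool ((x, ys ! j) \<in> parcs G)"] ys len set_eq
    by (simp add: adj_mat_def N_def)
  have 2: "N * M ys xs = adj_mat xs G"
  proof -
    have "transpose_mat N = mat n n (\<lambda>(i, j). of_bool ((xs ! j, ys ! i) \<in> parcs G))"
      "transpose_mat (adj_mat xs G) = mat n n (\<lambda>(i, j). of_bool ((xs ! j, xs ! i) \<in> parcs G))"
      by (rule eq_matI; simp add: adj_mat_def N_def len)+
    then have "M xs ys * transpose_mat N = transpose_mat (adj_mat xs G)"
      using mult[of ys xs "\<lambda>y j. of_bool ((xs ! j, y) \<in> parcs G)"] ys len set_eq by simp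
    moreover have "transpose_mat (M xs ys) = M ys xs"
      by (intro eq_matI) (auto simp: M_def)
    moreover have "transpose_mat (M xs ys * transpose_mat N) = N * transpose_mat (M xs ys)"
      by (subst transpose_mult[of _ n n _ n]) (auto simp: C N_def)
    ultimately show ?thesis by simp
  qed
  have "similar_mat_wit (adj_mat xs G) (adj_mat ys G) (M xs ys) (M ys xs)"
    using id[of xs ys] id[of ys xs] xs ys len set_eq A[of xs] A[of ys] C 1 2
    by (auto intro!: similar_mat_witI[of _ _ n])
  then show ?thesis unfolding similar_mat_def by blast
qed

lemma adj_spectrum_eq:
  assumes "distinct xs" "set xs = pverts G"
  shows "adj_spectrum G = mat_spectrum (adj_mat xs G)"
proof -
  let ?ys = "SOME xs. distinct xs \<and> set xs = pverts G"
  have "distinct ?ys \<and> set ?ys = pverts G"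
    by (rule someI[of _ xs]) (use assms in simp)
  then have "similar_mat (adj_mat ?ys G) (adj_mat xs G)"
    using assms by (intro similar_adj_mat) auto
  then show ?thesis
    unfolding adj_spectrum_def mat_spectrum_def by (simp add: char_poly_similar)
qed

lemma pair_graph_pockets:
  assumes F: "pair_graph F" and H: "pair_graph H"
  shows "pair_graph (pockets F k p H w)"
proof -
  interpret F: pair_graph F by (rule F)
  interpret H: pair_graph H by (rule H)
  have inj: "pocket_emb p w i x = pocket_emb p w i y \<longleftrightarrow> x = y" for i x y
    by (auto simp: pocket_emb_def)
  have arcs: "(x, y) \<in> parcs (pockets F k p H w) \<longleftrightarrow>
      (\<exists>a b. (a, b) \<in> parcs F \<and> x = Inl a \<and> y = Inl b) \<or>
      (\<exists>i\<in>{1..k}. \<exists>a b. (a, b) \<in> parcs H \<and> x = pocket_emb p w i a \<and> y = pocket_emb p w i b)"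
    for x y
    by (simp add: pockets_def image_iff Bex_def split_paired_Ex) blast
  show ?thesis
  proof
    fix e assume e: "e \<in> parcs (pockets F k p H w)"
    obtain x y where xy: "e = (x, y)" by (cases e)
    from e[unfolded xy arcs] have "x \<in> pverts (pockets F k p H w) \<and> y \<in> pverts (pockets F k p H w) \<and> x \<noteq> y"
    proof (elim disjE exE conjE bexE)
      fix a b assume ab: "(a, b) \<in> parcs F" and "x = Inl a" "y = Inl b"
      then show ?thesis
        using F.wellformed'[OF ab] F.pair_no_loops[OF ab] by (simp add: pockets_def)
    next
      fix i a b assume i: "i \<in> {1..k}" and ab: "(a, b) \<in> parcs H"
        and "x = pocket_emb p w i a" "y = pocket_emb p w i b"
      then show ?thesis
        using H.wellformed'[OF ab] H.pair_no_loops[OF ab] by (auto simp: pockets_def inj)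
    qed
    then show "fst e \<in> pverts (pockets F k p H w)" "snd e \<in> pverts (pockets F k p H w)"
      "fst e \<noteq> snd e"
      by (simp_all add: xy)
  next
    show "finite (pverts (pockets F k p H w))" "finite (parcs (pockets F k p H w))"
      using F.pair_finite_verts F.pair_finite_arcs H.pair_finite_verts H.pair_finite_arcs
      by (simp_all add: pockets_def)
  next
    have "(y, x) \<in> parcs F" if "(x, y) \<in> parcs F" for x y
      using that F.pair_sym_arcs by (simp add: symmetric_def sym_def)
    moreover have "(y, x) \<in> parcs H" if "(x, y) \<in> parcs H" for x y
      using that H.pair_sym_arcs by (simp add: symmetric_def sym_def)
    ultimately show "symmetric (with_proj (pockets F k p H w))"
      unfolding symmetric_def sym_def with_proj_simps arcs by blast
  qed
qed

end

theory Submission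
  imports Defs "Jordan_Normal_Form.Schur_Decomposition"
begin

text \<open>
  Let \<open>A\<close> be the adjacency matrix of the \<open>r\<close>-regular graph \<open>H - w\<close> on \<open>s\<close> vertices. Its
  all-ones vector is an eigenvector for \<open>r\<close>, so a Schur complement gives, for \<open>t\<close> other than \<open>r\<close>,
  the characteristic polynomial of \<open>H\<close> at \<open>t\<close> as \<open>(t - s / (t - r)) \<chi>\<^sub>A(t)\<close>, and that of
  the graph with pockets as \<open>det (t - A\<^sub>F - s / (t - r) D) \<chi>\<^sub>A(t)^k\<close>, where \<open>D\<close> is the
  diagonal matrix marking the vertices that carry a pocket. By the first formula \<open>H\<close> determines
  \<open>\<chi>\<^sub>A\<close>, and the second depends on \<open>H\<close> only through \<open>r\<close>, \<open>s\<close> and \<open>\<chi>\<^sub>A\<close>.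
\<close>

section \<open>Polynomial identities and block determinants\<close>

text \<open>Multiplying \<open>f - g\<close> by the linear factor with root \<open>a\<close> gives a
  polynomial that vanishes everywhere, hence is zero. This removes the exception
  \<open>t = r\<close> that the Schur complement formulas carry.\<close>

lemma poly_eqI_except:
  fixes f g :: "'a :: {idom, ring_char_0} poly"
  assumes "\<And>t. t \<noteq> a \<Longrightarrow> poly f t = poly g t"
  shows "f = g"
proof -
  have "poly ([:- a, 1:] * (f - g)) t = 0" for t
    using assms[of t] by (cases "t = a") auto
  then have "[:- a, 1:] * (f - g) = 0"
    using poly_all_0_iff_0 by blast
  then have "f - g = 0"
    by (metis mult_eq_0_iff pCons_eq_0_iff one_neq_zero)
  then show ?thesis by simp
qed

lemma poly_char_poly:
  fixes A :: "'a :: field mat"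
  assumes "A \<in> carrier_mat n n"
  shows "poly (char_poly A) t = det (t \<cdot>\<^sub>m 1\<^sub>m n - A)"
  unfolding char_poly_def
  by (rule poly_det_cong[of _ n]) (use assms in \<open>auto simp: char_poly_matrix_def\<close>)

text \<open>
  The columns of \<open>C\<close> being eigenvectors of \<open>D\<close>, the inverse in the Schur complement of
  \<open>t - D\<close> acts on \<open>C\<close> as division by \<open>t - r\<close>.
\<close>

lemma poly_char_poly_four_block_eigen:
  fixes A :: "'a :: field mat"
  assumes A: "A \<in> carrier_mat n n" and B: "B \<in> carrier_mat n m"
    and C: "C \<in> carrier_mat m n" and D: "D \<in> carrier_mat m m"
    and DC: "D * C = r \<cdot>\<^sub>m C" and t: "t \<noteq> r"
  shows "poly (char_poly (four_block_mat A B C D)) t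
    = det (t \<cdot>\<^sub>m 1\<^sub>m n - A - (1 / (t - r)) \<cdot>\<^sub>m (B * C)) * poly (char_poly D) t"
proof -
  \<comment> \<open>\<open>Q\<close> solves \<open>(t - D) * Q = C\<close>, because
    \<open>t - D\<close> multiplies each column of \<open>C\<close> by \<open>t - r\<close>. Right
    multiplication by \<open>N\<close> is then the column operation that clears the block
    \<open>- C\<close>. No inverse of \<open>t - D\<close> is formed, so \<open>t\<close> may be an
    eigenvalue of \<open>D\<close>.\<close>
  define Q where "Q = (1 / (t - r)) \<cdot>\<^sub>m C"
  define M where "M = four_block_mat (t \<cdot>\<^sub>m 1\<^sub>m n - A) (- B) (- C) (t \<cdot>\<^sub>m 1\<^sub>m m - D)"
  define N where "N = four_block_mat (1\<^sub>m n) (0\<^sub>m n m) Q (1\<^sub>m m)"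
  have Q: "Q \<in> carrier_mat m n" using C by (simp add: Q_def)
  have M: "M \<in> carrier_mat (n + m) (n + m)" and N: "N \<in> carrier_mat (n + m) (n + m)"
    using A B C D Q by (auto simp: M_def N_def)
  have "t \<cdot>\<^sub>m 1\<^sub>m (n + m) - four_block_mat A B C D = M"
    using A B C D unfolding M_def by (intro eq_matI) auto
  then have "poly (char_poly (four_block_mat A B C D)) t = det M"
    using A D by (simp add: poly_char_poly[of _ "n + m"])
  also have "\<dots> = det (M * N)"
  proof -
    have "det N = 1"
      unfolding N_def using Q by (simp add: det_four_block_mat_upper_right_zero[of _ n _ m])
    then show ?thesis by (simp add: det_mult[OF M N])
  qed
  also have "M * N = four_block_mat (t \<cdot>\<^sub>m 1\<^sub>m n - A - (1 / (t - r)) \<cdot>\<^sub>m (B * C)) (- B)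
      (0\<^sub>m m n) (t \<cdot>\<^sub>m 1\<^sub>m m - D)"
  proof -
    have "(t \<cdot>\<^sub>m 1\<^sub>m n - A) * 1\<^sub>m n + (- B) * Q
        = t \<cdot>\<^sub>m 1\<^sub>m n - A - (1 / (t - r)) \<cdot>\<^sub>m (B * C)"
    proof -
      have "(- B) * Q = - ((1 / (t - r)) \<cdot>\<^sub>m (B * C))"
        using B C by (intro eq_matI) (auto simp: Q_def scalar_prod_def sum_distrib_left sum_negf)
      then show ?thesis using A B C by auto
    qed
    moreover have "(t \<cdot>\<^sub>m 1\<^sub>m n - A) * 0\<^sub>m n m + (- B) * 1\<^sub>m m = - B"
      using A B by auto
    moreover have "(- C) * 1\<^sub>m n + (t \<cdot>\<^sub>m 1\<^sub>m m - D) * Q = 0\<^sub>m m n"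
    proof -
      have "(t \<cdot>\<^sub>m 1\<^sub>m m - D) * Q = (1 / (t - r)) \<cdot>\<^sub>m ((t \<cdot>\<^sub>m 1\<^sub>m m - D) * C)"
        unfolding Q_def using C D by (intro mult_smult_distrib[of _ m m _ n] minus_carrier_mat) auto
      also have "(t \<cdot>\<^sub>m 1\<^sub>m m - D) * C = t \<cdot>\<^sub>m C - r \<cdot>\<^sub>m C"
        using C D by (simp add: minus_mult_distrib_mat[of _ m m _ _ n] DC
            mult_smult_assoc_mat[of _ m m _ n])
      also have "(1 / (t - r)) \<cdot>\<^sub>m (t \<cdot>\<^sub>m C - r \<cdot>\<^sub>m C) = C"
        using t C by (intro eq_matI) (auto simp: field_simps)
      finally show ?thesis using C by auto
    qed
    moreover have "(- C) * 0\<^sub>m n m + (t \<cdot>\<^sub>m 1\<^sub>m m - D) * 1\<^sub>m m = t \<cdot>\<^sub>m 1\<^sub>m m - D"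
      using C D by auto
    ultimately show ?thesis
      unfolding M_def N_def using A B C D Q
      by (subst mult_four_block_mat[of _ n n _ m _ m _ _ n _ m]) auto
  qed
  also have "det \<dots> = det (t \<cdot>\<^sub>m 1\<^sub>m n - A - (1 / (t - r)) \<cdot>\<^sub>m (B * C)) * det (t \<cdot>\<^sub>m 1\<^sub>m m - D)"
    using A B C D by (intro det_four_block_mat_lower_left_zero[of _ n _ m]) auto
  finally show ?thesis
    using D by (simp add: poly_char_poly)
qed

text \<open>A complex characteristic polynomial is monic and splits, so it is recovered from the
  multiset of its roots as a product of linear factors.\<close>

lemma mat_spectrum_eq_iff:
  assumes A: "A \<in> carrier_mat n n" and B: "B \<in> carrier_mat m m"
  shows "mat_spectrum A = mat_spectrum B \<longleftrightarrow> char_poly A = char_poly B"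
proof -
  have "char_poly A = (\<Prod>a\<in>#mat_spectrum A. [:- a, 1:])"
    if A: "A \<in> carrier_mat n n" for A :: "complex mat" and n
  proof -
    obtain as where as: "char_poly A = (\<Prod>a\<leftarrow>as. [:- a, 1:])"
      using char_poly_factorized[OF A] by blast
    have "proots (\<Prod>a\<leftarrow>as. [:- a, 1:]) = mset as"
    proof (induction as)
      case (Cons a as)
      have "(\<Prod>a\<leftarrow>as. [:- a, 1:]) \<noteq> (0 :: complex poly)"
        by (auto simp: prod_list_zero_iff)
      with Cons show ?case by (simp add: proots_mult del: mult_pCons_left)
    qed simp
    with as show ?thesis
      unfolding mat_spectrum_def by (simp flip: prod_mset_prod_list)
  qed
  from this[OF A] this[OF B] show ?thesis
    unfolding mat_spectrum_def by metis
qed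

section \<open>Adjacency matrices split into blocks of vertices\<close>

definition cross_adj_mat :: "'a list \<Rightarrow> 'a list \<Rightarrow> 'a pair_pre_digraph \<Rightarrow> complex mat" where
  "cross_adj_mat xs ys G =
    mat (length xs) (length ys) (\<lambda>(i, j). of_bool ((xs ! i, ys ! j) \<in> parcs G))"

lemma cross_adj_mat_carrier [simp]:
  "cross_adj_mat xs ys G \<in> carrier_mat (length xs) (length ys)"
  by (simp add: cross_adj_mat_def)

lemma adj_mat_carrier [simp]: "adj_mat xs G \<in> carrier_mat (length xs) (length xs)"
  by (simp add: adj_mat_def)

lemma adj_mat_append:
  "adj_mat (xs @ ys) G =
    four_block_mat (adj_mat xs G) (cross_adj_mat xs ys G) (cross_adj_mat ys xs G) (adj_mat ys G)"
  by (intro eq_matI) (auto simp: adj_mat_def cross_adj_mat_def nth_append)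

lemma adj_mat_map_cong:
  assumes "\<And>x y. x \<in> set xs \<Longrightarrow> y \<in> set xs \<Longrightarrow> (f x, f y) \<in> parcs G \<longleftrightarrow> (x, y) \<in> parcs H"
  shows "adj_mat (map f xs) G = adj_mat xs H"
  using assms by (intro eq_matI) (auto simp: adj_mat_def)

text \<open>An entry of the product counts walks of length two with middle vertex in
  \<open>ys\<close>; this turns the matrix conditions below into counting.\<close>

lemma cross_adj_mat_mult:
  assumes "distinct ys"
  shows "cross_adj_mat xs ys G * cross_adj_mat ys zs G = mat (length xs) (length zs)
    (\<lambda>(i, j). of_nat (card {y \<in> set ys. (xs ! i, y) \<in> parcs G \<and> (y, zs ! j) \<in> parcs G}))"
proof (rule eq_matI; (simp add: cross_adj_mat_def; fail)?)
  fix i j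
  assume "i < dim_row (mat (length xs) (length zs) (\<lambda>(i, j). of_nat
      (card {y \<in> set ys. (xs ! i, y) \<in> parcs G \<and> (y, zs ! j) \<in> parcs G}) :: complex))"
    and "j < dim_col (mat (length xs) (length zs) (\<lambda>(i, j). of_nat
      (card {y \<in> set ys. (xs ! i, y) \<in> parcs G \<and> (y, zs ! j) \<in> parcs G}) :: complex))"
  then have ij: "i < length xs" "j < length zs" by auto
  let ?P = "\<lambda>y. (xs ! i, y) \<in> parcs G \<and> (y, zs ! j) \<in> parcs G"
  have "(cross_adj_mat xs ys G * cross_adj_mat ys zs G) $$ (i, j)
      = (\<Sum>l = 0..<length ys. of_bool (?P (ys ! l)))"
    using ij by (simp add: cross_adj_mat_def scalar_prod_def flip: of_bool_conj)
  also have "\<dots> = (\<Sum>y\<in>set ys. of_bool (?P y))"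
    using assms by (intro sum.reindex_bij_betw bij_betw_nth) auto
  also have "\<dots> = of_nat (card {y \<in> set ys. ?P y})"
    by (simp add: Int_def)
  finally show "(cross_adj_mat xs ys G * cross_adj_mat ys zs G) $$ (i, j) =
      mat (length xs) (length zs) (\<lambda>(i, j). of_nat
      (card {y \<in> set ys. (xs ! i, y) \<in> parcs G \<and> (y, zs ! j) \<in> parcs G})) $$ (i, j)"
    using ij by simp
qed

text \<open>The assumption \<open>eigen\<close> is the combinatorial form of
  \<open>D * C = r C\<close>: every column of the block from \<open>ys\<close> to \<open>xs\<close>
  is zero or an eigenvector of \<open>adj_mat ys G\<close> for \<open>r\<close>.\<close>

lemma poly_char_poly_adj_mat_append:
  assumes ys: "distinct ys"
    and eigen: "\<And>x y. x \<in> set xs \<Longrightarrow> y \<in> set ys \<Longrightarrow>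
      card {z \<in> set ys. (y, z) \<in> parcs G \<and> (z, x) \<in> parcs G} = (if (y, x) \<in> parcs G then r else 0)"
    and t: "t \<noteq> of_nat r"
  shows "poly (char_poly (adj_mat (xs @ ys) G)) t =
    det (t \<cdot>\<^sub>m 1\<^sub>m (length xs) - adj_mat xs G
      - (1 / (t - of_nat r)) \<cdot>\<^sub>m (cross_adj_mat xs ys G * cross_adj_mat ys xs G))
    * poly (char_poly (adj_mat ys G)) t"
proof -
  have "adj_mat ys G = cross_adj_mat ys ys G"
    by (simp add: adj_mat_def cross_adj_mat_def)
  then have "adj_mat ys G * cross_adj_mat ys xs G = of_nat r \<cdot>\<^sub>m cross_adj_mat ys xs G"
    using eigen unfolding \<open>adj_mat ys G = _\<close> cross_adj_mat_mult[OF ys]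
    by (intro eq_matI) (auto simp: cross_adj_mat_def)
  then show ?thesis
    unfolding adj_mat_append
    by (intro poly_char_poly_four_block_eigen[where m = "length ys"] t) auto
qed

text \<open>Without arcs from \<open>ys\<close> to \<open>xs\<close> the matrix is block upper
  triangular.\<close>

lemma char_poly_adj_mat_append_disconnected:
  assumes "\<And>x y. x \<in> set xs \<Longrightarrow> y \<in> set ys \<Longrightarrow> (y, x) \<notin> parcs G"
  shows "char_poly (adj_mat (xs @ ys) G) = char_poly (adj_mat xs G) * char_poly (adj_mat ys G)"
proof (rule char_poly_0_block)
  show "adj_mat (xs @ ys) G = four_block_mat (adj_mat xs G) (cross_adj_mat xs ys G)
      (0\<^sub>m (length ys) (length xs)) (adj_mat ys G)"
    unfolding adj_mat_append using assms
    by (intro cong_four_block_mat eq_matI) (auto simp: cross_adj_mat_def)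
\<comment> \<open>The block rule asks that the characteristic polynomials of the diagonal blocks
  split, which holds over the complex numbers.\<close>
qed (use char_poly_factorized[OF adj_mat_carrier] in auto)

section \<open>Cones over regular graphs and the pockets made of them\<close>

lemma pocket_emb_eq_iff:
  "Inl a = pocket_emb p w i x \<longleftrightarrow> x = w \<and> a = p i"
  "Inr (j, y) = pocket_emb p w i x \<longleftrightarrow> x \<noteq> w \<and> j = i \<and> y = x"
  by (auto simp: pocket_emb_def)

lemma pockets_arcs_iff:
  "(x, y) \<in> parcs (pockets F k p H w) \<longleftrightarrow>
    (\<exists>a b. (a, b) \<in> parcs F \<and> x = Inl a \<and> y = Inl b) \<or>
    (\<exists>i\<in>{1..k}. \<exists>a b. (a, b) \<in> parcs H \<and> x = pocket_emb p w i a \<and> y = pocket_emb p w i b)"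
  by (simp add: pockets_def image_iff Bex_def split_paired_Ex) blast

text \<open>Common form of the hypotheses on \<open>Hu\<close> and \<open>Hv\<close>. The base
  \<open>H - w\<close> is given as a list because its order fixes the rows and columns of the
  matrices.\<close>

locale regular_cone = pair_graph H for H :: "'b pair_pre_digraph" +
  fixes w :: 'b and hs :: "'b list" and r :: nat
  assumes distinct_base: "distinct hs" and set_base: "set hs = pverts H - {w}"
    and apex_vert: "w \<in> pverts H"
    and apex_arc: "x \<in> set hs \<Longrightarrow> (w, x) \<in> parcs H"
    and base_regular: "x \<in> set hs \<Longrightarrow> card {y \<in> set hs. (x, y) \<in> parcs H} = r"
begin

lemma apex_notin_base: "w \<notin> set hs"
  by (simp add: set_base)

lemma no_loop: "(x, x) \<notin> parcs H"
  using pair_no_loops by fastforce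

lemma arc_apex: "x \<in> set hs \<Longrightarrow> (x, w) \<in> parcs H"
  using apex_arc pair_sym_arcs by (simp add: symmetric_def sym_def)

text \<open>The Schur complement of the base is the scalar \<open>t - s / (t - r)\<close> with
  \<open>s = length hs\<close>. Clearing the denominator gives an identity of polynomials, valid at
  \<open>r\<close> too.\<close>

lemma char_poly_cone:
  "[:- of_nat r, 1:] * char_poly (adj_mat (w # hs) H)
    = [:- of_nat (length hs), - of_nat r, 1:] * char_poly (adj_mat hs H)"
proof (rule poly_eqI_except)
  fix t :: complex
  assume t: "t \<noteq> of_nat r"
  let ?M = "t \<cdot>\<^sub>m 1\<^sub>m (length [w]) - adj_mat [w] H
      - (1 / (t - of_nat r)) \<cdot>\<^sub>m (cross_adj_mat [w] hs H * cross_adj_mat hs [w] H)"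
  have "poly (char_poly (adj_mat ([w] @ hs) H)) t = det ?M * poly (char_poly (adj_mat hs H)) t"
  proof (rule poly_char_poly_adj_mat_append[OF distinct_base _ t])
    fix x y assume "x \<in> set [w]" and y: "y \<in> set hs"
    \<comment> \<open>All base vertices are adjacent to \<open>w\<close>, so the column of
      \<open>w\<close> is the all-ones vector and regularity makes it an eigenvector.\<close>
    then have "{z \<in> set hs. (y, z) \<in> parcs H \<and> (z, x) \<in> parcs H} = {z \<in> set hs. (y, z) \<in> parcs H}"
      using arc_apex by auto
    then show "card {z \<in> set hs. (y, z) \<in> parcs H \<and> (z, x) \<in> parcs H} =
        (if (y, x) \<in> parcs H then r else 0)"
      using base_regular y arc_apex \<open>x \<in> set [w]\<close> by simp
  qed
  moreover have "det ?M = t - of_nat (length hs) / (t - of_nat r)"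
  proof -
    have "{y \<in> set hs. (w, y) \<in> parcs H \<and> (y, w) \<in> parcs H} = set hs"
      using arc_apex apex_arc by auto
    then have "card {y \<in> set hs. (w, y) \<in> parcs H \<and> (y, w) \<in> parcs H} = length hs"
      by (simp add: distinct_card distinct_base)
    then show ?thesis
      by (subst det_single)
         (auto simp: cross_adj_mat_mult[OF distinct_base] adj_mat_def no_loop)
  qed
  ultimately have "poly (char_poly (adj_mat (w # hs) H)) t
      = (t - of_nat (length hs) / (t - of_nat r)) * poly (char_poly (adj_mat hs H)) t"
    by simp
  moreover have "(t - of_nat r) * (t - of_nat (length hs) / (t - of_nat r))
      = t * (t - of_nat r) - of_nat (length hs)"
    using t by (simp add: field_simps)
  ultimately have "(t - of_nat r) * poly (char_poly (adj_mat (w # hs) H)) t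
      = (t * (t - of_nat r) - of_nat (length hs)) * poly (char_poly (adj_mat hs H)) t"
    by (simp only: flip: mult.assoc)
  then show "poly ([:- of_nat r, 1:] * char_poly (adj_mat (w # hs) H)) t
    = poly ([:- of_nat (length hs), - of_nat r, 1:] * char_poly (adj_mat hs H)) t"
    by (simp add: algebra_simps)
qed

context
  fixes F :: "'a pair_pre_digraph" and p :: "nat \<Rightarrow> 'a" and k :: nat
begin

private abbreviation P where "P \<equiv> pockets F k p H w"

text \<open>An arc of a copy with both ends in \<open>F\<close> would come from a loop at
  \<open>w\<close>.\<close>

lemma pockets_arcs_Inl_Inl: "(Inl a, Inl b) \<in> parcs P \<longleftrightarrow> (a, b) \<in> parcs F"
  by (auto simp: pockets_arcs_iff pocket_emb_eq_iff no_loop)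

lemma pockets_arcs_Inl_Inr:
  assumes "x \<in> set hs"
  shows "(Inl a, Inr (i, x)) \<in> parcs P \<longleftrightarrow> i \<in> {1..k} \<and> a = p i"
  using assms apex_arc[of x] apex_notin_base
  by (auto simp: pockets_arcs_iff pocket_emb_eq_iff)

lemma pockets_arcs_Inr_Inl:
  assumes "x \<in> set hs"
  shows "(Inr (i, x), Inl a) \<in> parcs P \<longleftrightarrow> i \<in> {1..k} \<and> a = p i"
  using assms arc_apex[of x] apex_notin_base
  by (auto simp: pockets_arcs_iff pocket_emb_eq_iff)

lemma pockets_arcs_Inr_Inr:
  assumes "x \<in> set hs" "y \<in> set hs"
  shows "(Inr (i, x), Inr (j, y)) \<in> parcs P \<longleftrightarrow> i = j \<and> i \<in> {1..k} \<and> (x, y) \<in> parcs H"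
  using assms apex_notin_base
  by (auto simp: pockets_arcs_iff pocket_emb_eq_iff)

text \<open>Bases of different copies are not joined, so each induction step splits off one diagonal
  block equal to \<open>adj_mat hs H\<close>.\<close>

lemma char_poly_copies:
  assumes "distinct is" "set is \<subseteq> {1..k}"
  shows "char_poly (adj_mat (map Inr (List.product is hs)) P) = char_poly (adj_mat hs H) ^ length is"
  using assms
proof (induction "is")
  case Nil
  show ?case
    \<comment> \<open>The characteristic polynomial of the empty matrix is monic of degree 0, hence
      1.\<close>
    using degree_monic_char_poly[OF adj_mat_carrier, of "[]" P]
    by (auto elim!: degree_eq_zeroE)
next
  case (Cons i "is")
  have "adj_mat (map (\<lambda>x. Inr (i, x)) hs) P = adj_mat hs H"
    using Cons.prems by (intro adj_mat_map_cong) (auto simp: pockets_arcs_Inr_Inr)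
  moreover have "char_poly (adj_mat
        (map (\<lambda>x. Inr (i, x)) hs @ map Inr (List.product is hs)) P)
      = char_poly (adj_mat (map (\<lambda>x. Inr (i, x)) hs) P)
        * char_poly (adj_mat (map Inr (List.product is hs)) P)"
    using Cons.prems
    by (intro char_poly_adj_mat_append_disconnected) (auto simp: pockets_arcs_Inr_Inr)
  ultimately show ?case
    using Cons by (simp add: comp_def)
qed

text \<open>
  The product \<open>N N\<^sup>T\<close> is the matrix \<open>s D\<close> of the introduction; only its independence of
  \<open>H\<close> is needed, so it is left unevaluated.
\<close>

lemma poly_char_poly_pockets:
  fixes fs :: "'a list"
  defines "N \<equiv> mat (length fs) (k * length hs)
    (\<lambda>(i, j). of_bool (fs ! i = p (Suc (j div length hs))) :: complex)"
  assumes t: "t \<noteq> of_nat r"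
  shows "poly (char_poly (adj_mat (map Inl fs @ map Inr (List.product [1..<Suc k] hs)) P)) t =
    det (t \<cdot>\<^sub>m 1\<^sub>m (length fs) - adj_mat fs F - (1 / (t - of_nat r)) \<cdot>\<^sub>m (N * transpose_mat N))
    * poly (char_poly (adj_mat hs H)) t ^ k"
proof -
  let ?ys = "map Inr (List.product [1..<Suc k] hs) :: ('a + nat \<times> 'b) list"
  let ?xs = "map Inl fs :: ('a + nat \<times> 'b) list"
  \<comment> \<open>The product list runs through the copies one after another: \<open>div\<close>
    finds the copy, \<open>mod\<close> the place in its base. \<open>Suc\<close> appears because
    copies are numbered from 1.\<close>
  have nth: "?ys ! j = Inr (Suc (j div length hs), hs ! (j mod length hs))"
      "Suc (j div length hs) \<le> k" "hs ! (j mod length hs) \<in> set hs"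
    if "j < k * length hs" for j
  proof -
    from that have "0 < length hs" by (cases hs) auto
    then show "hs ! (j mod length hs) \<in> set hs" by simp
    show 1: "Suc (j div length hs) \<le> k"
      using that by (simp add: less_mult_imp_div_less Suc_le_eq)
    show "?ys ! j = Inr (Suc (j div length hs), hs ! (j mod length hs))"
      using that 1 by (simp add: product_nth del: upt_Suc)
  qed
  have len: "length ?ys = k * length hs" by simp
  have xy: "cross_adj_mat ?xs ?ys P = N"
    using nth unfolding N_def
    by (intro eq_matI) (auto simp: cross_adj_mat_def pockets_arcs_Inl_Inr simp del: upt_Suc)
  have yx: "cross_adj_mat ?ys ?xs P = transpose_mat N"
    using nth unfolding N_def
    by (intro eq_matI) (auto simp: cross_adj_mat_def pockets_arcs_Inr_Inl simp del: upt_Suc)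
  have "poly (char_poly (adj_mat (?xs @ ?ys) P)) t =
      det (t \<cdot>\<^sub>m 1\<^sub>m (length ?xs) - adj_mat ?xs P
        - (1 / (t - of_nat r)) \<cdot>\<^sub>m (cross_adj_mat ?xs ?ys P * cross_adj_mat ?ys ?xs P))
      * poly (char_poly (adj_mat ?ys P)) t"
  proof (rule poly_char_poly_adj_mat_append[OF _ _ t])
    show "distinct ?ys"
      using distinct_base by (simp add: distinct_map distinct_product)
    fix x y
    assume "x \<in> set ?xs" "y \<in> set ?ys"
    then obtain a i h where x: "x = Inl a" and y: "y = Inr (i, h)"
      and i: "i \<in> {1..k}" and h: "h \<in> set hs"
      by auto
    \<comment> \<open>The new neighbours of \<open>y\<close> lie in its own copy \<open>i\<close>,
      and they all see \<open>a\<close> exactly when that copy is attached there.\<close>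
    have "{z \<in> set ?ys. (y, z) \<in> parcs P \<and> (z, x) \<in> parcs P}
        = (if a = p i then (\<lambda>g. Inr (i, g)) ` {g \<in> set hs. (h, g) \<in> parcs H} else {})"
      using h i unfolding x y by (auto simp: pockets_arcs_Inr_Inr pockets_arcs_Inr_Inl)
    moreover have "card ((\<lambda>g. Inr (i, g)) ` {g \<in> set hs. (h, g) \<in> parcs H} :: ('a + nat \<times> 'b) set) = r"
      using base_regular[OF h] by (subst card_image) (auto simp: inj_on_def)
    ultimately show "card {z \<in> set ?ys. (y, z) \<in> parcs P \<and> (z, x) \<in> parcs P} =
        (if (y, x) \<in> parcs P then r else 0)"
      using h i unfolding x y by (simp add: pockets_arcs_Inr_Inl del: set_map upt_Suc set_upt)
  qed
  moreover have "adj_mat ?xs P = adj_mat fs F"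
    by (intro adj_mat_map_cong) (simp add: pockets_arcs_Inl_Inl)
  moreover have "char_poly (adj_mat ?ys P) = char_poly (adj_mat hs H) ^ k"
    using char_poly_copies[of "[1..<Suc k]"] by (simp add: atLeastLessThanSuc_atLeastAtMost del: upt_Suc)
  ultimately show ?thesis
    unfolding xy yx by simp
qed

text \<open>The glued vertices \<open>p i\<close> already belong to \<open>F\<close>, so a copy adds
  only its base.\<close>

lemma pverts_pockets:
  assumes "p ` {1..k} \<subseteq> pverts F"
  shows "pverts P = Inl ` pverts F \<union> Inr ` ({1..k} \<times> set hs)"
  using assms apex_vert by (auto simp: pockets_def pocket_emb_def set_base image_iff)

lemma adj_spectrum_pockets:
  assumes "p ` {1..k} \<subseteq> pverts F" "distinct fs" "set fs = pverts F"
  shows "adj_spectrum P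
    = mat_spectrum (adj_mat (map Inl fs @ map Inr (List.product [1..<Suc k] hs)) P)"
  using assms(2,3) distinct_base pverts_pockets[OF assms(1)]
  by (intro adj_spectrum_eq)
     (auto simp: distinct_map distinct_product simp del: upt_Suc)

end

lemma adj_spectrum_cone: "adj_spectrum H = mat_spectrum (adj_mat (w # hs) H)"
  using distinct_base set_base apex_vert by (intro adj_spectrum_eq) auto

end

section \<open>Comparison of the two graphs with pockets\<close>

lemma A_cospectral_pockets:
  assumes "regular_cone H w hs r" and "regular_cone H' w' hs' r"
    and len: "length hs = length hs'"
    and p: "p ` {1..k} \<subseteq> pverts F" and "A_cospectral H H'" and F: "finite (pverts F)"
  shows "A_cospectral (pockets F k p H w) (pockets F k p H' w')"
proof -
  interpret H: regular_cone H w hs r by fact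
  interpret H': regular_cone H' w' hs' r by fact
  obtain fs where fs: "distinct fs" "set fs = pverts F"
    using finite_distinct_list[OF F] by blast
  have "char_poly (adj_mat (w # hs) H) = char_poly (adj_mat (w' # hs') H')"
    using \<open>A_cospectral H H'\<close> mat_spectrum_eq_iff[OF adj_mat_carrier adj_mat_carrier]
    unfolding A_cospectral_def H.adj_spectrum_cone H'.adj_spectrum_cone by blast
  then have "[:- of_nat (length hs), - of_nat r, 1:] * char_poly (adj_mat hs H)
      = [:- of_nat (length hs), - of_nat r, 1:] * char_poly (adj_mat hs' H')"
    using H.char_poly_cone H'.char_poly_cone len by metis
  \<comment> \<open>The common quadratic factor has leading coefficient 1, so it can be
    cancelled.\<close>
  then have "char_poly (adj_mat hs H) = char_poly (adj_mat hs' H')"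
    by (subst (asm) mult_left_cancel) auto
  \<comment> \<open>The matrix \<open>N\<close> in the formula for pockets depends on the base only
    through its length, so by \<open>len\<close> both sides agree away from
    \<open>r\<close>.\<close>
  then have "char_poly (adj_mat (map Inl fs @ map Inr (List.product [1..<Suc k] hs)) (pockets F k p H w))
    = char_poly (adj_mat (map Inl fs @ map Inr (List.product [1..<Suc k] hs')) (pockets F k p H' w'))"
    by (intro poly_eqI_except[of "of_nat r"])
       (simp add: H.poly_char_poly_pockets H'.poly_char_poly_pockets len del: upt_Suc One_nat_def)
  then show ?thesis
    unfolding A_cospectral_def H.adj_spectrum_pockets[OF p fs] H'.adj_spectrum_pockets[OF p fs]
    by (simp add: mat_spectrum_def)
qed

text \<open>The neighbours of \<open>w\<close> lie among the other vertices and are equally many, so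
  they are all of them. Deleting \<open>w\<close> leaves at \<open>x\<close> exactly the arcs into
  \<open>hs\<close>, which turns \<open>regular\<close> into a count.\<close>

lemma (in pair_graph) regular_coneI:
  assumes w: "w \<in> pverts G" and deg: "out_degree G w = card (pverts G) - 1"
    and reg: "regular r (pre_digraph.del_vert G w)"
    and hs: "distinct hs" "set hs = pverts G - {w}"
  shows "regular_cone G w hs r"
proof
  show "distinct hs" "set hs = pverts G - {w}" "w \<in> pverts G" by fact+
next
  fix x assume x: "x \<in> set hs"
  let ?N = "{y. (w, y) \<in> parcs G}"
  have "out_arcs G w = Pair w ` ?N"
    by (auto simp: out_arcs_def)
  then have "card ?N = card (pverts G - {w})"
    using deg w by (simp add: out_degree_def card_image inj_on_def)
  moreover have "?N \<subseteq> pverts G - {w}"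
    using wellformed' pair_no_loops by fastforce
  ultimately have "?N = pverts G - {w}"
    by (intro card_subset_eq) auto
  then show "(w, x) \<in> parcs G" using x hs by auto
next
  fix x assume x: "x \<in> set hs"
  have "out_arcs (pre_digraph.del_vert G w) x = Pair x ` {y \<in> set hs. (x, y) \<in> parcs G}"
    using x hs wellformed' by (auto simp: out_arcs_def pre_digraph.del_vert_def)
  then have "out_degree (pre_digraph.del_vert G w) x = card {y \<in> set hs. (x, y) \<in> parcs G}"
    by (simp add: out_degree_def card_image inj_on_def)
  then show "card {y \<in> set hs. (x, y) \<in> parcs G} = r"
    using reg x hs by (simp add: regular_def pre_digraph.del_vert_def)
qed

theorem corollary3p3:
  fixes F :: "'a pair_pre_digraph" and Hu Hv :: "'b pair_pre_digraph"
    and p :: "nat \<Rightarrow> 'a" and u v :: 'b and n m k r\<^sub>1 :: nat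
  assumes "pair_graph F" and "card (pverts F) = n" and "n \<ge> 1"
    and "p ` {1..k} \<subseteq> pverts F" and "card (p ` {1..k}) = k"
    and "pair_graph Hu" and "pair_graph Hv" and "pverts Hu \<inter> pverts Hv = {}"
    and "card (pverts Hu) = m" and "card (pverts Hv) = m" and "m \<ge> 2"
    and "u \<in> pverts Hu" and "out_degree Hu u = m - 1"
    and "v \<in> pverts Hv" and "out_degree Hv v = m - 1"
    and "regular r\<^sub>1 (pre_digraph.del_vert Hu u)"
    and "regular r\<^sub>1 (pre_digraph.del_vert Hv v)" and "r\<^sub>1 \<ge> 1"
    and "A_cospectral Hu Hv"
  shows "A_cospectral (pockets F k p Hu u) (pockets F k p Hv v)"
proof -
  interpret F: pair_graph F by fact
  interpret Hu: pair_graph Hu by fact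
  interpret Hv: pair_graph Hv by fact
  obtain us where us: "distinct us" "set us = pverts Hu - {u}"
    using finite_distinct_list[of "pverts Hu - {u}"] by auto
  obtain vs where vs: "distinct vs" "set vs = pverts Hv - {v}"
    using finite_distinct_list[of "pverts Hv - {v}"] by auto
  have "regular_cone Hu u us r\<^sub>1"
    using assms us by (intro Hu.regular_coneI) auto
  moreover have "regular_cone Hv v vs r\<^sub>1"
    using assms vs by (intro Hv.regular_coneI) auto
  moreover have "length us = length vs"
    using assms us vs by (simp flip: distinct_card)
  ultimately show ?thesis
    \<comment> \<open>The two cited assumptions place the pockets at vertices of \<open>F\<close>
      and give the cospectrality of \<open>Hu\<close> and \<open>Hv\<close>.\<close>
    using assms(4,19) F.pair_finite_verts by (rule A_cospectral_pockets)
qed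

end
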